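(* Consider the descriptor system $Ex_{k+1}=Ax_k+Bu_k+w_k$, $y_{k+1}=Hx_{k+1}+v_k$ with $E,A\in\mathbb{R}^{n_1\times n}$, $H\in\mathbb{R}^{m\times n}$, where $\begin{bmatrix}E&A\end{bmatrix}$ has full row rank, $\begin{bmatrix}E^T&H^T\end{bmatrix}^T$ has full column rank, and $P_0,Q,R$ are symmetric positive definite. Suppose the system is detectable and stabilizable (as defined in the context). Let $P_k^{(+)}$ and $\Gamma_k^{sm}$ be as defined in the context, and for integers $b\ge0$, $c\ge1$ define $M_1^{(b)}=I$ and $M_q^{(b)}=M_{q-1}^{(b)}\,\Gamma^{sm}_{b+q-1}A^TQ^{-1}E$ for $q=2,\dots,c$. Then $$\big\|(\Gamma_{b+1}^{sm})^{-1}M_c^{(b)}\big\|_{i2}\to0\quad\text{as } c\to\infty \text{ and } b\to\infty,$$ where $\|\cdot\|_{i2}$ is the matrix norm induced by the Euclidean norm.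
   Context: Recursion: $P_0^{(+)}=P_0$, $P_0^{(-)}=AP_0A^T+Q$, and for $k\ge1$: $P_k^{(+)}=(E^T(P_{k-1}^{(-)})^{-1}E+H^TR^{-1}H)^{-1}$, $P_k^{(-)}=AP_k^{(+)}A^T+Q$; and $\Gamma_k^{sm}=((P_k^{(+)})^{-1}+A^TQ^{-1}A)^{-1}$. Detectability: $\mathrm{rank}\begin{bmatrix}\mu E-\phi A\\ H\end{bmatrix}=n$ for all complex pairs $(\mu,\phi)\neq(0,0)$ with $|\mu|\ge|\phi|$. Stabilizability: $\mathrm{rank}\begin{bmatrix}\mu E-\phi A & Q & 0\\ \mu H & 0 & R\end{bmatrix}=n_1+m$ for almost all complex pairs $(\mu,\phi)\neq(0,0)$ with $|\mu|\ge|\phi|$. *)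

theory Defs
  imports "HOL-Analysis.Analysis"
begin

definition sym_pos_def_mat :: "real^'n^'n \<Rightarrow> bool" where
  "sym_pos_def_mat P \<longleftrightarrow> transpose P = P \<and> (\<forall>x. x \<noteq> 0 \<longrightarrow> x \<bullet> (P *v x) > 0)"

definition cmat :: "real^'c^'r \<Rightarrow> complex^'c^'r" where
  "cmat M = (\<chi> i j. complex_of_real (M $ i $ j))"

definition smat :: "'a::times \<Rightarrow> 'a^'c^'r \<Rightarrow> 'a^'c^'r" where
  "smat c M = (\<chi> i j. c * M $ i $ j)"

definition hcat :: "'a::zero^'c1^'r \<Rightarrow> 'a^'c2^'r \<Rightarrow> 'a^('c1 + 'c2)^'r" where
  "hcat X Y = (\<chi> i j. case j of Inl a \<Rightarrow> X $ i $ a | Inr b \<Rightarrow> Y $ i $ b)"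

definition vcat :: "'a::zero^'c^'r1 \<Rightarrow> 'a^'c^'r2 \<Rightarrow> 'a^'c^('r1 + 'r2)" where
  "vcat X Y = (\<chi> i. case i of Inl a \<Rightarrow> X $ a | Inr b \<Rightarrow> Y $ b)"

definition detectable :: "real^'n^'n1 \<Rightarrow> real^'n^'n1 \<Rightarrow> real^'n^'m \<Rightarrow> bool" where
  "detectable E A H \<longleftrightarrow>
     (\<forall>\<mu> \<phi> :: complex. (\<mu>, \<phi>) \<noteq> (0, 0) \<and> norm \<mu> \<ge> norm \<phi> \<longrightarrow>
        rank (vcat (smat \<mu> (cmat E) - smat \<phi> (cmat A)) (cmat H)) = CARD('n))"

text \<open>Stabilizability: rank [mu E - phi A, Q, 0; mu H, 0, R] = n1 + m for almost all
  (mu,phi) \<noteq> (0,0) with |mu| \<ge> |phi|; "almost all" is read as "all but finitely many".\<close>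
definition stabilizable ::
  "real^'n^'n1 \<Rightarrow> real^'n^'n1 \<Rightarrow> real^'n^'m \<Rightarrow> real^'n1^'n1 \<Rightarrow> real^'m^'m \<Rightarrow> bool" where
  "stabilizable E A H Q R \<longleftrightarrow>
     finite {(\<mu>, \<phi>) | \<mu> \<phi> :: complex. (\<mu>, \<phi>) \<noteq> (0, 0) \<and> norm \<mu> \<ge> norm \<phi> \<and>
        rank (vcat (hcat (smat \<mu> (cmat E) - smat \<phi> (cmat A)) (hcat (cmat Q) (0 :: complex^'m^'n1)))
                   (hcat (smat \<mu> (cmat H)) (hcat (0 :: complex^'n1^'m) (cmat R))))
          \<noteq> CARD('n1) + CARD('m)}"

primrec Pplus ::
  "real^'n^'n1 \<Rightarrow> real^'n^'n1 \<Rightarrow> real^'n^'m \<Rightarrow> real^'n^'n \<Rightarrow> real^'n1^'n1 \<Rightarrow> real^'m^'m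
   \<Rightarrow> nat \<Rightarrow> real^'n^'n" where
  "Pplus E A H P0 Q R 0 = P0"
| "Pplus E A H P0 Q R (Suc k) =
     matrix_inv (transpose E ** matrix_inv (A ** Pplus E A H P0 Q R k ** transpose A + Q) ** E
                 + transpose H ** matrix_inv R ** H)"

definition Pminus ::
  "real^'n^'n1 \<Rightarrow> real^'n^'n1 \<Rightarrow> real^'n^'m \<Rightarrow> real^'n^'n \<Rightarrow> real^'n1^'n1 \<Rightarrow> real^'m^'m
   \<Rightarrow> nat \<Rightarrow> real^'n1^'n1" where
  "Pminus E A H P0 Q R k = A ** Pplus E A H P0 Q R k ** transpose A + Q"

definition Gamma_sm ::
  "real^'n^'n1 \<Rightarrow> real^'n^'n1 \<Rightarrow> real^'n^'m \<Rightarrow> real^'n^'n \<Rightarrow> real^'n1^'n1 \<Rightarrow> real^'m^'m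
   \<Rightarrow> nat \<Rightarrow> real^'n^'n" where
  "Gamma_sm E A H P0 Q R k =
     matrix_inv (matrix_inv (Pplus E A H P0 Q R k) + transpose A ** matrix_inv Q ** A)"

text \<open>Mprod b j = M_{j+1}^{(b)}: M_1 = I, M_q = M_{q-1} Gamma_{b+q-1} A^T Q^{-1} E.\<close>
primrec Mprod ::
  "real^'n^'n1 \<Rightarrow> real^'n^'n1 \<Rightarrow> real^'n^'m \<Rightarrow> real^'n^'n \<Rightarrow> real^'n1^'n1 \<Rightarrow> real^'m^'m
   \<Rightarrow> nat \<Rightarrow> nat \<Rightarrow> real^'n^'n" where
  "Mprod E A H P0 Q R b 0 = mat 1"
| "Mprod E A H P0 Q R b (Suc j) =
     Mprod E A H P0 Q R b j ** Gamma_sm E A H P0 Q R (b + j + 1) ** transpose A ** matrix_inv Q ** E"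

definition Mmat ::
  "real^'n^'n1 \<Rightarrow> real^'n^'n1 \<Rightarrow> real^'n^'m \<Rightarrow> real^'n^'n \<Rightarrow> real^'n1^'n1 \<Rightarrow> real^'m^'m
   \<Rightarrow> nat \<Rightarrow> nat \<Rightarrow> real^'n^'n" where
  "Mmat E A H P0 Q R b c = Mprod E A H P0 Q R b (c - 1)"

definition induced_norm2 :: "real^'c^'r \<Rightarrow> real" where
  "induced_norm2 M = onorm (\<lambda>x. M *v x)"

end

theory Submission
  imports Defs "HOL-Computational_Algebra.Fundamental_Theorem_Algebra"
begin

text \<open>
  Put \<open>F\<^sub>k = \<Gamma>\<^sub>k A\<^sup>T Q\<^sup>-\<^sup>1 E\<close> and \<open>V\<^sub>k(x) = x \<bullet> (P\<^sub>k\<^sup>-\<^sup>1 x)\<close>. Completing the square gives the dissipation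
  identity \<open>V\<^sub>k\<^sub>+\<^sub>1(y) = V\<^sub>k(F\<^sub>k y) + |E y - A F\<^sub>k y|\<^sup>2 + |H y|\<^sup>2\<close> (norms weighted by \<open>Q\<^sup>-\<^sup>1\<close> and
  \<open>R\<^sup>-\<^sup>1\<close>), so \<open>V\<close> decreases along the backward trajectories \<open>x\<^sub>k = F\<^sub>k x\<^sub>k\<^sub>+\<^sub>1\<close> that the product \<open>M\<^sub>c\<close>
  generates.

  Detectability excludes nonzero bounded sequences with \<open>E z\<^sub>j = A z\<^sub>j\<^sub>+\<^sub>1\<close> and \<open>H z\<^sub>j = 0\<close>: such a
  sequence is annihilated by a polynomial in the shift, hence yields an eigensequence
  \<open>z\<^sub>j = \<lambda>\<^sup>j v\<close> with \<open>|\<lambda>| \<le> 1\<close>, and \<open>v\<close> lies in the kernel of the detectability pencil at \<open>(1, \<lambda>)\<close>. By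
  compactness of a product of balls there is a quantitative version on finite windows. It bounds
  \<open>V\<^sub>k\<close> from below uniformly in \<open>k\<close>, and then makes \<open>V\<close> shrink by a fixed factor over each window.
  Finally \<open>\<Gamma>\<^sub>b\<^sub>+\<^sub>1\<^sup>-\<^sup>1 M\<^sub>c = A\<^sup>T Q\<^sup>-\<^sup>1 E F\<^sub>b\<^sub>+\<^sub>2 \<cdots> F\<^sub>b\<^sub>+\<^sub>c\<^sub>-\<^sub>1\<close>, so the decay of the trajectories suffices.
\<close>

section \<open>Bounded backward trajectories\<close>

lemma full_column_rank_kernel:
  fixes M :: "'a::field^'n^'m"
  assumes "rank M = CARD('n)" "M *v x = 0"
  shows "x = 0"
proof -
  have "vec.dim (rows M) = vec.dim (UNIV :: ('a^'n) set)"
    using assms(1) by (simp add: row_rank_def_gen vec.dim_UNIV card_cart_basis vec.dimension_def)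
  then have "vec.span (rows M) = UNIV"
    using vec.dim_eq_span[of "rows M" UNIV] by simp
  then have "\<exists>B. B ** M = mat 1"
    by (simp add: matrix_left_invertible_span_rows_gen)
  with assms(2) show ?thesis
    by (meson matrix_left_invertible_ker)
qed

lemma vcat_mult_eq_0_iff:
  fixes X :: "'a::semiring_1^'c^'r1" and Y :: "'a^'c^'r2"
  shows "vcat X Y *v x = 0 \<longleftrightarrow> X *v x = 0 \<and> Y *v x = 0"
proof -
  have "(vcat X Y *v x) $ Inl a = (X *v x) $ a" "(vcat X Y *v x) $ Inr b = (Y *v x) $ b" for a b
    by (simp_all add: vcat_def matrix_vector_mult_def)
  then show ?thesis
    by (simp add: vec_eq_iff split_sum_all)
qed

lemma matrix_vector_mult_sum:
  fixes M :: "'a::semiring_1^'c^'r"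
  shows "M *v (\<Sum>i\<in>I. f i) = (\<Sum>i\<in>I. M *v f i)"
  by (induction I rule: infinite_finite_induct) (simp_all add: matrix_vector_right_distrib)

lemma smat_mult_vec:
  fixes M :: "'a::comm_semiring_1^'c^'r"
  shows "smat c M *v x = c *s (M *v x)"
  by (simp add: smat_def matrix_vector_mult_def vec_eq_iff sum_distrib_left mult.assoc)

text \<open>The pencil is normalised to \<mu> = 1, which is admissible because |\<phi>| \<le> 1. The
  case \<phi> = 0 says that \<open>E\<close> and \<open>H\<close> have no common nonzero kernel
  vector.\<close>

lemma detectable_kernel:
  fixes E A :: "real^'n^'n1" and H :: "real^'n^'m" and v :: "complex^'n"
  assumes "detectable E A H" "norm \<phi> \<le> 1"
    and "cmat E *v v = \<phi> *s (cmat A *v v)" "cmat H *v v = 0"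
  shows "v = 0"
proof (rule full_column_rank_kernel)
  show "rank (vcat (smat 1 (cmat E) - smat \<phi> (cmat A)) (cmat H)) = CARD('n)"
    using assms(1,2) unfolding detectable_def by (metis norm_one one_neq_zero prod.inject)
  show "vcat (smat 1 (cmat E) - smat \<phi> (cmat A)) (cmat H) *v v = 0"
    using assms(3,4) by (simp add: vcat_mult_eq_0_iff matrix_vector_mult_diff_rdistrib smat_mult_vec)
qed

text \<open>n + 1 vectors in dimension n are dependent. Dependence is a property of sets, so a
  repeated value gets its own relation with coefficients 1 and -1.\<close>

lemma exists_linear_relation:
  fixes f :: "nat \<Rightarrow> 'a::field^'n"
  shows "\<exists>a. (\<exists>i\<le>CARD('n). a i \<noteq> 0) \<and> (\<Sum>i\<le>CARD('n). a i *s f i) = 0"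
proof (cases "inj_on f {..CARD('n)}")
  case True
  have "vec.dependent (f ` {..CARD('n)})"
  proof (rule vec.dependent_biggerset_general)
    have "vec.dim (f ` {..CARD('n)}) \<le> CARD('n)"
      using vec.dim_subset_UNIV[of "f ` {..CARD('n)}"]
      by (simp add: card_cart_basis vec.dimension_def)
    then show "card (f ` {..CARD('n)}) > vec.dim (f ` {..CARD('n)})"
      using True by (simp add: card_image)
  qed
  then obtain u where u: "\<exists>v\<in>f ` {..CARD('n)}. u v \<noteq> 0" "(\<Sum>v\<in>f ` {..CARD('n)}. u v *s v) = 0"
    by (auto simp: vec.dependent_finite)
  then show ?thesis
    using True by (intro exI[of _ "u \<circ> f"]) (auto simp: sum.reindex)
next
  case False
  then obtain i j where ij: "i \<le> CARD('n)" "j \<le> CARD('n)" "i \<noteq> j" "f i = f j"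
    by (auto simp: inj_on_def)
  define a :: "nat \<Rightarrow> 'a" where "a = (\<lambda>k. if k = i then 1 else if k = j then - 1 else 0)"
  have "(\<Sum>k\<le>CARD('n). a k *s f k) = (\<Sum>k\<in>{i, j}. a k *s f k)"
    using ij by (intro sum.mono_neutral_right) (auto simp: a_def)
  also have "\<dots> = 0"
    using ij by (simp add: a_def)
  finally show ?thesis
    using ij by (intro exI[of _ a]) (auto simp: a_def)
qed

text \<open>Sequences bounded by \<open>K\<close> form a product of closed balls, compact in the
  product topology by Tychonoff. Nestedness reduces a finite intersection to a single
  \<open>S n\<close>.\<close>

lemma nested_closed_sequences_nonempty:
  fixes S :: "nat \<Rightarrow> (nat \<Rightarrow> 'a::{real_normed_vector, heine_borel}) set"
  assumes "\<And>n. closed (S n)" "\<And>m n. m \<le> n \<Longrightarrow> S n \<subseteq> S m"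
    and "\<And>n. \<exists>z\<in>S n. \<forall>j. norm (z j) \<le> K"
  shows "\<exists>z. (\<forall>n. z \<in> S n) \<and> (\<forall>j. norm (z j) \<le> K)"
proof -
  define C :: "(nat \<Rightarrow> 'a) set" where "C = Pi\<^sub>E UNIV (\<lambda>_. cball 0 K)"
  have "compactin (product_topology (\<lambda>_. euclidean) UNIV) C"
    unfolding C_def by (subst compactin_PiE) auto
  then have "compact C"
    by (metis compactin_euclidean_iff euclidean_product_topology)
  then have "C \<inter> (\<Inter>n\<in>UNIV. S n) \<noteq> {}"
  proof (rule compact_imp_fip_image)
    fix I :: "nat set"
    assume "finite I"
    then obtain n where "\<forall>i\<in>I. i \<le> n"
      using finite_nat_set_iff_bounded_le by blast
    moreover obtain z where "z \<in> S n" "\<forall>j. norm (z j) \<le> K"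
      using assms(3) by blast
    ultimately have "z \<in> C \<inter> (\<Inter>n\<in>I. S n)"
      by (auto simp: C_def intro: subsetD[OF assms(2)])
    then show "C \<inter> (\<Inter>n\<in>I. S n) \<noteq> {}" by blast
  qed (use assms in auto)
  then show ?thesis
    by (simp add: C_def PiE_iff ex_in_conv[symmetric]) blast
qed

section \<open>Polynomials in the shift that annihilate a trajectory\<close>

definition shift_poly :: "complex poly \<Rightarrow> (nat \<Rightarrow> complex^'n) \<Rightarrow> nat \<Rightarrow> complex^'n" where
  "shift_poly p z j = (\<Sum>i\<le>degree p. coeff p i *s z (j + i))"

lemma shift_poly_eq:
  assumes "degree p \<le> N"
  shows "shift_poly p z j = (\<Sum>i\<le>N. coeff p i *s z (j + i))"
  unfolding shift_poly_def
  by (rule sum.mono_neutral_left) (use assms in \<open>auto simp: coeff_eq_0\<close>)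

text \<open>With T the shift, p(T) = q(T) (T - c): splitting a root off p means passing from z to T
  z - c z.\<close>

lemma shift_poly_linear_factor:
  "shift_poly ([:- c, 1:] * q) z j = shift_poly q (\<lambda>j. z (Suc j) - c *s z j) j"
proof -
  have eq: "[:- c, 1:] * q = pCons 0 q - smult c q"
    by simp
  have "degree ([:- c, 1:] * q) \<le> Suc (degree q)"
    using degree_mult_le[of "[:- c, 1:]" q] by simp
  then have "shift_poly ([:- c, 1:] * q) z j
      = (\<Sum>i\<le>Suc (degree q). coeff ([:- c, 1:] * q) i *s z (j + i))"
    by (rule shift_poly_eq)
  also have "\<dots> = (\<Sum>i\<le>Suc (degree q). coeff (pCons 0 q) i *s z (j + i))
      - (\<Sum>i\<le>Suc (degree q). (c * coeff q i) *s z (j + i))"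
    unfolding eq by (simp only: coeff_diff coeff_smult vec.scale_left_diff_distrib sum_subtractf)
  also have "(\<Sum>i\<le>Suc (degree q). coeff (pCons 0 q) i *s z (j + i))
      = (\<Sum>i\<le>degree q. coeff q i *s z (Suc (j + i)))"
    by (subst sum.atMost_Suc_shift) simp
  also have "(\<Sum>i\<le>Suc (degree q). (c * coeff q i) *s z (j + i))
      = (\<Sum>i\<le>degree q. (c * coeff q i) *s z (j + i))"
    by (simp add: coeff_eq_0)
  finally show ?thesis
    by (simp add: shift_poly_def vec.scale_right_diff_distrib sum_subtractf mult.commute)
qed

text \<open>The index runs backward in time: \<open>z (Suc j)\<close> precedes \<open>z j\<close>.
  The states are complex so that an annihilating polynomial has roots.\<close>

definition backward_traj ::
  "real^'n^'n1 \<Rightarrow> real^'n^'n1 \<Rightarrow> real^'n^'m \<Rightarrow> (nat \<Rightarrow> complex^'n) \<Rightarrow> bool" where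
  "backward_traj E A H z \<longleftrightarrow>
     (\<forall>j. cmat E *v z j = cmat A *v z (Suc j)) \<and> (\<forall>j. cmat H *v z j = 0) \<and>
     (\<exists>K. \<forall>j k. norm (z j $ k) \<le> K)"

lemma backward_traj_diff:
  assumes "backward_traj E A H z"
  shows "backward_traj E A H (\<lambda>j. z (Suc j) - c *s z j)"
proof -
  obtain K where "\<forall>j k. norm (z j $ k) \<le> K"
    using assms by (auto simp: backward_traj_def)
  then have "norm ((z (Suc j) - c *s z j) $ k) \<le> K + norm c * K" for j k
    using norm_triangle_ineq4[of "z (Suc j) $ k" "c * z j $ k"]
      mult_left_mono[of "norm (z j $ k)" K "norm c"]
    by (simp add: norm_mult) (smt (verit))
  then show ?thesis
    using assms unfolding backward_traj_def
    by (simp add: matrix_vector_mult_diff_distrib vector_scalar_commute) blast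
qed

lemma geometric_bounded_imp_le_1:
  fixes r d K :: real
  assumes "d > 0" "\<And>j. r ^ j * d \<le> K"
  shows "r \<le> 1"
proof (rule ccontr)
  assume "\<not> r \<le> 1"
  then obtain j where "K / d < r ^ j"
    using real_arch_pow[of r "K / d"] by auto
  then show False
    using assms(1) assms(2)[of j] by (simp add: field_simps)
qed

text \<open>After a root c is split off, the quotient annihilates the trajectory with entries
  \<open>z (Suc j) - c *s z j\<close>, which is zero by induction on the degree. So z is geometric
  with ratio c; boundedness of a nonzero z forces |c| \<le> 1, which detectability excludes.\<close>

lemma backward_traj_annihilated:
  fixes E A :: "real^'n^'n1" and H :: "real^'n^'m"
  assumes det: "detectable E A H"
  shows "p \<noteq> 0 \<Longrightarrow> backward_traj E A H z \<Longrightarrow> \<forall>j. shift_poly p z j = 0 \<Longrightarrow> z j = 0"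
proof (induction "degree p" arbitrary: p z j)
  case 0
  then obtain c where "p = [:c:]" "c \<noteq> 0"
    by (metis degree_eq_zeroE pCons_0_0)
  with 0 show ?case
    by (simp add: shift_poly_def)
next
  case (Suc d)
  then have "\<not> constant (poly p)"
    by (simp add: constant_degree)
  then obtain c where "poly p c = 0"
    using fundamental_theorem_of_algebra by blast
  then obtain q where q: "p = [:- c, 1:] * q"
    by (auto simp: poly_eq_0_iff_dvd)
  with Suc have "q \<noteq> 0"
    by auto
  then have "d = degree q"
    using Suc.hyps(2) unfolding q by (subst (asm) degree_mult_eq) auto
  have "\<forall>j. shift_poly q (\<lambda>j. z (Suc j) - c *s z j) j = 0"
    using Suc.prems(3) unfolding q shift_poly_linear_factor by simp
  then have "z (Suc j) - c *s z j = 0" for j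
    using Suc.hyps(1)[OF \<open>d = degree q\<close> \<open>q \<noteq> 0\<close> backward_traj_diff[OF Suc.prems(2)]] by blast
  then have step: "z (Suc j) = c *s z j" for j
    by simp
  have pow: "z j = c ^ j *s z 0" for j
    by (induction j) (simp_all add: step)
  have "z 0 = 0"
  proof (rule ccontr)
    assume nz: "z 0 \<noteq> 0"
    then obtain k where k: "z 0 $ k \<noteq> 0"
      by (auto simp: vec_eq_iff)
    obtain K where K: "\<forall>j k. norm (z j $ k) \<le> K"
      using Suc.prems by (auto simp: backward_traj_def)
    have "norm c ^ j * norm (z 0 $ k) \<le> K" for j
      using K[rule_format, of j k] unfolding pow[of j] by (simp add: norm_mult norm_power)
    then have "norm c \<le> 1"
      using k geometric_bounded_imp_le_1[of "norm (z 0 $ k)" "norm c" K] by simp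
    moreover have "cmat E *v z 0 = c *s (cmat A *v z 0)" "cmat H *v z 0 = 0"
      using Suc.prems(2) by (auto simp: backward_traj_def step vector_scalar_commute)
    ultimately show False
      using detectable_kernel[OF det] nz by blast
  qed
  then show ?case
    unfolding pow[of j] by simp
qed

text \<open>If \<open>y (Suc j)\<close> is zero, then \<open>E\<close> and \<open>H\<close> both
  annihilate \<open>y j\<close>, and detectability at \<phi> = 0 makes it zero.\<close>

lemma backward_traj_0_imp_earlier_0:
  fixes E A :: "real^'n^'n1" and H :: "real^'n^'m"
  assumes det: "detectable E A H"
    and y: "\<And>j. cmat E *v y j = cmat A *v y (Suc j)" "\<And>j. cmat H *v y j = 0"
    and "y m = 0" "j \<le> m"
  shows "y j = 0"
  using \<open>j \<le> m\<close>
proof (induction rule: inc_induct)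
  case base
  show ?case by fact
next
  case (step j)
  then show ?case
    using detectable_kernel[OF det, of 0 "y j"] y[of j] by simp
qed

lemma exists_argmax_atMost:
  fixes f :: "nat \<Rightarrow> 'b::linorder"
  shows "\<exists>i0\<le>n. \<forall>i\<le>n. f i \<le> f i0"
proof -
  have "Max (f ` {..n}) \<in> f ` {..n}"
    by (intro Max_in) auto
  then obtain i0 where "i0 \<le> n" "f i0 = Max (f ` {..n})"
    by (metis atMost_iff imageE)
  then show ?thesis
    by (intro exI[of _ i0]) simp
qed

text \<open>The relations of length \<open>n + 1\<close> annihilating the trajectory up to index \<open>m\<close> decrease
  with \<open>m\<close>, so after normalisation compactness provides one that works for all indices.\<close>

lemma backward_traj_zero:
  fixes E A :: "real^'n^'n1" and H :: "real^'n^'m"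
  assumes det: "detectable E A H" and z: "backward_traj E A H z"
  shows "z j = 0"
proof -
  let ?n = "CARD('n)"
  \<comment> \<open>Asking for a coefficient equal to 1 excludes the zero relation by a closed
    condition.\<close>
  define S where "S m = {a :: nat \<Rightarrow> complex. (\<exists>i\<in>{..?n}. a i = 1) \<and>
      (\<forall>j\<le>m. \<forall>k. (\<Sum>i\<le>?n. a i * z (j + i) $ k) = 0)}" for m
  have "\<exists>a. (\<forall>m. a \<in> S m) \<and> (\<forall>j. norm (a j) \<le> 1)"
  proof (rule nested_closed_sequences_nonempty)
    fix m
    have "S m = (\<Union>i\<in>{..?n}. {a. a i = 1}) \<inter>
        (\<Inter>j\<in>{..m}. \<Inter>k. {a. (\<Sum>i\<le>?n. a i * z (j + i) $ k) = 0})"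
      by (auto simp: S_def)
    moreover have "closed \<dots>"
      by (intro closed_Int closed_UN closed_INT ballI closed_Collect_eq continuous_intros
          continuous_on_product_coordinates) auto
    ultimately show "closed (S m)" by simp
    show "S m' \<subseteq> S m" if "m \<le> m'" for m'
      using that by (auto simp: S_def)
    \<comment> \<open>A relation is needed only at index \<open>m\<close>: the combination
      \<open>y\<close> below obeys the trajectory equations, so its zero at \<open>m\<close> spreads
      to all smaller indices.\<close>
    obtain a i where a: "i \<le> ?n" "a i \<noteq> 0" "(\<Sum>i\<le>?n. a i *s z (m + i)) = 0"
      using exists_linear_relation[of "\<lambda>i. z (m + i)"] by blast
    \<comment> \<open>Dividing by a coefficient of largest modulus puts all coefficients in the unit
      disc and makes one of them 1.\<close>
    obtain i0 where i0: "i0 \<le> ?n" "\<forall>i\<le>?n. norm (a i) \<le> norm (a i0)"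
      using exists_argmax_atMost[of ?n "\<lambda>i. norm (a i)"] by blast
    with a have nz: "a i0 \<noteq> 0"
      by (metis norm_le_zero_iff norm_zero)
    define a' where "a' i = (if i \<le> ?n then a i / a i0 else 0)" for i
    define y where "y j = (\<Sum>i\<le>?n. a' i *s z (j + i))" for j
    have "y m = (\<Sum>i\<le>?n. inverse (a i0) *s (a i *s z (m + i)))"
      by (simp add: y_def a'_def divide_inverse mult.commute)
    also have "\<dots> = 0"
      unfolding vec.scale_sum_right[symmetric] a(3) by simp
    finally have "y m = 0" .
    have y: "cmat E *v y j = cmat A *v y (Suc j)" "cmat H *v y j = 0" for j
      using z by (simp_all add: y_def backward_traj_def matrix_vector_mult_sum
          vector_scalar_commute)
    have "y j = 0" if "j \<le> m" for j
      using backward_traj_0_imp_earlier_0[OF det y \<open>y m = 0\<close> that] .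
    then have "(\<Sum>i\<le>?n. a' i * z (j + i) $ k) = 0" if "j \<le> m" for j k
      using that by (simp add: y_def vec_eq_iff)
    moreover have "a' i0 = 1"
      using nz i0 by (simp add: a'_def)
    ultimately have "a' \<in> S m"
      using i0(1) by (auto simp: S_def)
    moreover have "norm (a' i) \<le> 1" for i
      using i0 nz by (simp add: a'_def norm_divide)
    ultimately show "\<exists>a\<in>S m. \<forall>j. norm (a j) \<le> 1" by blast
  qed
  then obtain a where a: "\<And>m. a \<in> S m" by blast
  define p where "p = Poly (map a [0..<Suc ?n])"
  have coeff_p: "coeff p i = (if i \<le> ?n then a i else 0)" for i
    by (auto simp: p_def nth_default_def simp del: upt_Suc)
  have "p \<noteq> 0"
    using a[of 0] coeff_p by (auto simp: S_def) (metis coeff_0 zero_neq_one)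
  moreover have "degree p \<le> ?n"
    by (intro degree_le) (simp add: coeff_p)
  then have "\<forall>j. shift_poly p z j = 0"
    using a by (simp add: shift_poly_eq coeff_p vec_eq_iff S_def) blast
  ultimately show ?thesis
    using backward_traj_annihilated[OF det _ z] by blast
qed

section \<open>Real trajectories and the estimate on finite windows\<close>

lemma cmat_mult_of_real:
  "cmat M *v (\<chi> i. complex_of_real (x $ i)) = (\<chi> i. complex_of_real ((M *v x) $ i))"
  by (simp add: cmat_def matrix_vector_mult_def vec_eq_iff)

lemma bounded_traj_zero:
  fixes E A :: "real^'n^'n1" and H :: "real^'n^'m"
  assumes det: "detectable E A H"
    and z: "\<And>j. E *v z j = A *v z (Suc j)" "\<And>j. H *v z j = 0" "\<And>j. norm (z j) \<le> K"
  shows "z j = 0"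
proof -
  have "backward_traj E A H (\<lambda>j. \<chi> i. complex_of_real (z j $ i))"
    unfolding backward_traj_def cmat_mult_of_real z(1,2)
    using z(3) by (auto simp: vec_eq_iff intro!: exI[of _ K] order_trans[OF component_le_norm_cart])
  from backward_traj_zero[OF det this, of j] show ?thesis
    by (simp add: vec_eq_iff)
qed

text \<open>If every window and every \<delta> failed, rescaled counterexamples on growing windows
  would have a common limit by compactness: a bounded sequence of zero cost with
  \<open>norm (z 0) = 1\<close>, which detectability forbids.\<close>

lemma uniform_observability:
  fixes E A :: "real^'n^'n1" and H :: "real^'n^'m"
  assumes det: "detectable E A H"
  shows "\<exists>N \<delta>. \<delta> > 0 \<and> (\<forall>z. (\<forall>j\<le>N. norm (z j) \<le> K * norm (z 0)) \<longrightarrow>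
     \<delta> * (norm (z 0))\<^sup>2 \<le> (\<Sum>j<N. (norm (E *v z j - A *v z (Suc j)))\<^sup>2 + (norm (H *v z j))\<^sup>2))"
proof (rule ccontr)
  define cost where "cost z j = (norm (E *v z j - A *v z (Suc j)))\<^sup>2 + (norm (H *v z j))\<^sup>2"
    for z :: "nat \<Rightarrow> real^'n" and j
  have cost_nonneg: "0 \<le> cost z j" for z j
    by (simp add: cost_def)
  assume "\<not> ?thesis"
  then have neg: "\<exists>z. (\<forall>j\<le>N. norm (z j) \<le> K * norm (z 0)) \<and>
      (\<Sum>j<N. cost z j) < \<delta> * (norm (z 0))\<^sup>2" if "\<delta> > 0" for N \<delta>
    using that unfolding cost_def by (meson not_le)
  \<comment> \<open>The tolerance shrinks while the sum of costs grows with \<open>N\<close>, so the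
    sets are nested and a common element has zero cost throughout.\<close>
  define S where "S N = {z. norm (z 0) = 1 \<and> (\<Sum>j<N. cost z j) \<le> 1 / Suc N}" for N
  have "\<exists>z. (\<forall>N. z \<in> S N) \<and> (\<forall>j. norm (z j) \<le> K)"
  proof (rule nested_closed_sequences_nonempty)
    fix N
    show "closed (S N)"
      unfolding S_def cost_def
      by (intro closed_Collect_conj closed_Collect_eq closed_Collect_le continuous_intros
          continuous_on_product_coordinates
          continuous_on_compose2[OF matrix_vector_mult_linear_continuous_on[of UNIV]]) auto
    show "S N' \<subseteq> S N" if "N \<le> N'" for N'
    proof
      fix z assume "z \<in> S N'"
      moreover have "(\<Sum>j<N. cost z j) \<le> (\<Sum>j<N'. cost z j)"
        using that by (intro sum_mono2) (auto simp: cost_nonneg)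
      moreover have "1 / real (Suc N') \<le> 1 / Suc N"
        using that by (simp add: frac_le)
      ultimately show "z \<in> S N"
        unfolding S_def mem_Collect_eq by linarith
    qed
    obtain z where z: "\<forall>j\<le>N. norm (z j) \<le> K * norm (z 0)"
        "(\<Sum>j<N. cost z j) < 1 / Suc N * (norm (z 0))\<^sup>2"
      using neg[of "1 / Suc N" N] by auto
    have "0 \<le> (\<Sum>j<N. cost z j)"
      by (simp add: sum_nonneg cost_nonneg)
    with z(2) have nz: "norm (z 0) > 0"
      by (metis less_le_not_le mult_zero_right norm_eq_zero power_zero_numeral zero_less_norm_iff)
    with z(1)[rule_format, of 0] have "1 \<le> K"
      by simp
    \<comment> \<open>Costs below \<open>N\<close> involve entries up to \<open>N\<close> only, so
      the tail can be cut off; it obeys the bound because \<open>K\<close> is nonnegative.\<close>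
    define z' where "z' j = (if j \<le> N then z j /\<^sub>R norm (z 0) else 0)" for j
    have "cost z' j = cost z j / (norm (z 0))\<^sup>2" if "j < N" for j
      using that
      by (simp add: cost_def z'_def matrix_vector_mult_scaleR add_divide_distrib power_mult_distrib
          power_inverse divide_inverse algebra_simps flip: scaleR_diff_right)
    then have "(\<Sum>j<N. cost z' j) = (\<Sum>j<N. cost z j) / (norm (z 0))\<^sup>2"
      by (simp add: sum_divide_distrib)
    also have "\<dots> \<le> 1 / Suc N"
      using z(2) nz by (simp add: divide_le_eq)
    finally have "z' \<in> S N"
      using nz by (simp add: S_def z'_def)
    moreover have "norm (z' j) \<le> K" for j
      using z(1)[rule_format, of j] nz \<open>1 \<le> K\<close> by (auto simp: z'_def field_simps)
    ultimately show "\<exists>z\<in>S N. \<forall>j. norm (z j) \<le> K" by blast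
  qed
  then obtain z where z: "\<And>N. z \<in> S N" "\<And>j. norm (z j) \<le> K" by blast
  have "cost z j = 0" for j
  proof -
    have "cost z j \<le> 1 / Suc N" if "j < N" for N
    proof -
      have "cost z j \<le> (\<Sum>j<N. cost z j)"
        using that by (intro member_le_sum) (auto simp: cost_nonneg)
      also have "\<dots> \<le> 1 / Suc N"
        using z(1)[of N] by (simp add: S_def)
      finally show ?thesis .
    qed
    then have "eventually (\<lambda>N. cost z j \<le> 1 / Suc N) sequentially"
      by (rule eventually_mono[OF eventually_gt_at_top])
    moreover have "(\<lambda>N. 1 / real (Suc N)) \<longlonglongrightarrow> 0"
      using LIMSEQ_inverse_real_of_nat by (simp add: inverse_eq_divide)
    ultimately have "cost z j \<le> 0"
      by (intro tendsto_lowerbound[of _ 0 sequentially]) auto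
    then show ?thesis
      using cost_nonneg[of z j] by simp
  qed
  then have "E *v z j = A *v z (Suc j)" "H *v z j = 0" for j
    by (simp_all add: cost_def add_nonneg_eq_0_iff)
  then have "z 0 = 0"
    using bounded_traj_zero[OF det] z(2) by blast
  with z(1)[of 0] show False
    by (simp add: S_def)
qed

section \<open>Positive definite matrices and the smoothing step\<close>

declare transpose_matrix_vector [simp del]

section \<open>Inverses, congruences and bounds of positive definite matrices\<close>

lemma invertible_matrix_inv:
  fixes M :: "'a::semiring_1^'n^'m"
  assumes "invertible M"
  shows "M ** matrix_inv M = mat 1" "matrix_inv M ** M = mat 1"
  using someI_ex[OF assms[unfolded invertible_def]] unfolding matrix_inv_def by blast+

lemma inner_matrix_transpose:
  fixes M :: "real^'n^'m"
  shows "x \<bullet> (M *v y) = (transpose M *v x) \<bullet> y"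
  by (metis dot_lmul_matrix transpose_matrix_vector)

lemma sym_pos_def_mat_invertible:
  assumes "sym_pos_def_mat P"
  shows "invertible P"
proof -
  have "x = 0" if "P *v x = 0" for x
    using assms that unfolding sym_pos_def_mat_def by (metis inner_zero_right less_irrefl)
  then show ?thesis
    by (simp add: invertible_left_inverse matrix_left_invertible_ker)
qed

lemma sym_pos_def_mat_inv_cancel:
  assumes "sym_pos_def_mat P"
  shows "P *v (matrix_inv P *v x) = x" "matrix_inv P *v (P *v x) = x"
  using invertible_matrix_inv[OF sym_pos_def_mat_invertible[OF assms]]
  by (simp_all add: matrix_vector_mul_assoc)

lemma sym_pos_def_mat_nonneg:
  assumes "sym_pos_def_mat P"
  shows "0 \<le> x \<bullet> (P *v x)"
  using assms by (cases "x = 0") (auto simp: sym_pos_def_mat_def less_imp_le)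

lemma sym_pos_def_mat_commute:
  assumes "sym_pos_def_mat P"
  shows "x \<bullet> (P *v y) = (P *v x) \<bullet> y"
  using assms by (simp add: inner_matrix_transpose sym_pos_def_mat_def)

lemma sym_pos_def_mat_matrix_inv:
  assumes P: "sym_pos_def_mat P"
  shows "sym_pos_def_mat (matrix_inv P)"
  unfolding sym_pos_def_mat_def
proof (intro conjI allI impI)
  have inv: "P ** matrix_inv P = mat 1" "matrix_inv P ** P = mat 1"
    using invertible_matrix_inv[OF sym_pos_def_mat_invertible[OF P]] .
  have "transpose (matrix_inv P) ** P = mat 1"
    using arg_cong[OF inv(1), of transpose] P
    by (simp add: matrix_transpose_mul sym_pos_def_mat_def transpose_mat)
  then show "transpose (matrix_inv P) = matrix_inv P"
    by (metis inv(1) matrix_mul_assoc matrix_mul_lid matrix_mul_rid)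
next
  fix x :: "real^'a" assume "x \<noteq> 0"
  then have "matrix_inv P *v x \<noteq> 0"
    using sym_pos_def_mat_inv_cancel(1)[OF P, of x] by auto
  then have "0 < (matrix_inv P *v x) \<bullet> (P *v (matrix_inv P *v x))"
    using P by (simp add: sym_pos_def_mat_def)
  then show "0 < x \<bullet> (matrix_inv P *v x)"
    by (simp add: sym_pos_def_mat_inv_cancel[OF P] inner_commute)
qed

lemma transpose_add: "transpose (M + N) = transpose M + transpose N"
  by (simp add: transpose_def vec_eq_iff)

lemma transpose_congruence:
  fixes P :: "real^'m^'m"
  assumes "transpose P = P"
  shows "transpose (transpose M ** P ** M) = transpose M ** P ** M"
  using assms by (simp add: matrix_transpose_mul matrix_mul_assoc)

lemma inner_congruence:
  fixes M :: "real^'n^'m"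
  shows "x \<bullet> ((transpose M ** P ** M) *v x) = (M *v x) \<bullet> (P *v (M *v x))"
  by (simp add: inner_matrix_transpose flip: matrix_vector_mul_assoc)

lemma sym_pos_def_mat_add_congruence:
  fixes M :: "real^'n^'m"
  assumes "sym_pos_def_mat P" "sym_pos_def_mat Q"
  shows "sym_pos_def_mat (P + transpose M ** Q ** M)"
  using assms sym_pos_def_mat_nonneg[OF assms(2)]
  by (simp add: sym_pos_def_mat_def transpose_add transpose_congruence
      matrix_vector_mult_add_rdistrib inner_add_right inner_congruence add_pos_nonneg)

text \<open>The form could vanish only on a common kernel vector of \<open>E\<close> and
  \<open>H\<close>. This keeps the matrix inverted in the recursion positive definite.\<close>

lemma sym_pos_def_mat_congruence_add_congruence:
  fixes E :: "real^'n^'m" and H :: "real^'n^'l"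
  assumes "rank (vcat E H) = CARD('n)" and P: "sym_pos_def_mat P" and Q: "sym_pos_def_mat Q"
  shows "sym_pos_def_mat (transpose E ** P ** E + transpose H ** Q ** H)"
  unfolding sym_pos_def_mat_def
proof (intro conjI allI impI)
  show "transpose (transpose E ** P ** E + transpose H ** Q ** H)
      = transpose E ** P ** E + transpose H ** Q ** H"
    using P Q by (simp add: transpose_add transpose_congruence sym_pos_def_mat_def)
next
  fix x :: "real^'n" assume "x \<noteq> 0"
  then have "E *v x \<noteq> 0 \<or> H *v x \<noteq> 0"
    using full_column_rank_kernel[OF assms(1)] vcat_mult_eq_0_iff by blast
  then have "0 < (E *v x) \<bullet> (P *v (E *v x)) + (H *v x) \<bullet> (Q *v (H *v x))"
    using P Q sym_pos_def_mat_nonneg[OF P] sym_pos_def_mat_nonneg[OF Q]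
    unfolding sym_pos_def_mat_def by (metis add_nonneg_pos add_pos_nonneg)
  then show "0 < x \<bullet> ((transpose E ** P ** E + transpose H ** Q ** H) *v x)"
    by (simp add: matrix_vector_mult_add_rdistrib inner_add_right inner_congruence)
qed

text \<open>The constant is the minimum of the form on the unit sphere; homogeneity does the
  rest.\<close>

lemma sym_pos_def_mat_lower_bound:
  fixes P :: "real^'n^'n"
  assumes "sym_pos_def_mat P"
  shows "\<exists>\<alpha>>0. \<forall>x. \<alpha> * (norm x)\<^sup>2 \<le> x \<bullet> (P *v x)"
proof -
  have "sphere (0::real^'n) 1 \<noteq> {}"
    by simp
  moreover have "continuous_on (sphere 0 1) (\<lambda>x. x \<bullet> (P *v x))"
    by (intro continuous_on_inner continuous_on_id matrix_vector_mult_linear_continuous_on)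
  ultimately obtain u where u: "u \<in> sphere 0 1" "\<forall>x\<in>sphere 0 1. u \<bullet> (P *v u) \<le> x \<bullet> (P *v x)"
    using continuous_attains_inf[OF compact_sphere] by blast
  have "u \<bullet> (P *v u) * (norm x)\<^sup>2 \<le> x \<bullet> (P *v x)" for x
  proof (cases "x = 0")
    case False
    then have "x /\<^sub>R norm x \<in> sphere 0 1"
      by simp
    then have "u \<bullet> (P *v u) \<le> (x /\<^sub>R norm x) \<bullet> (P *v (x /\<^sub>R norm x))"
      using u by blast
    also have "\<dots> = x \<bullet> (P *v x) / (norm x)\<^sup>2"
      by (simp add: matrix_vector_mult_scaleR power2_eq_square divide_inverse mult.commute mult.left_commute)
    finally show ?thesis
      using False by (simp add: pos_le_divide_eq)
  qed simp
  moreover have "0 < u \<bullet> (P *v u)"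
    using assms u(1) unfolding sym_pos_def_mat_def by (metis mem_sphere_0 norm_zero zero_neq_one)
  ultimately show ?thesis by blast
qed

lemma quadratic_form_upper_bound:
  fixes P :: "real^'n^'n"
  shows "\<exists>C>0. \<forall>x. x \<bullet> (P *v x) \<le> C * (norm x)\<^sup>2"
proof (intro exI conjI allI)
  have bl: "bounded_linear ((*v) P)"
    by (rule matrix_vector_mul_bounded_linear)
  then have nonneg: "0 \<le> onorm ((*v) P)"
    by (rule onorm_pos_le)
  then show "0 < onorm ((*v) P) + 1" by simp
  fix x
  have "x \<bullet> (P *v x) \<le> norm x * norm (P *v x)"
    by (rule norm_cauchy_schwarz)
  also have "\<dots> \<le> norm x * (onorm ((*v) P) * norm x)"
    by (intro mult_left_mono onorm[OF bl]) simp
  also have "\<dots> \<le> (onorm ((*v) P) + 1) * (norm x)\<^sup>2"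
    by (simp add: power2_eq_square algebra_simps)
  finally show "x \<bullet> (P *v x) \<le> (onorm ((*v) P) + 1) * (norm x)\<^sup>2" .
qed

section \<open>One prediction and smoothing step\<close>

context
  fixes A :: "real^'n^'m" and P :: "real^'n^'n" and Q :: "real^'m^'m"
  assumes P: "sym_pos_def_mat P" and Q: "sym_pos_def_mat Q"
begin

lemma sym_pos_def_mat_prediction: "sym_pos_def_mat (A ** P ** transpose A + Q)"
  using sym_pos_def_mat_add_congruence[OF Q P, of "transpose A"]
  by (simp add: transpose_transpose add.commute)

text \<open>Applying the prediction covariance to \<open>w\<close> splits \<open>e\<close> into a
  part carried by the state and a part carried by the noise, so that quadratic forms in its inverse
  can be expanded in \<open>w\<close>.\<close>

lemma prediction_split:
  fixes e :: "real^'m"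
  defines "w \<equiv> matrix_inv (A ** P ** transpose A + Q) *v e"
  shows "e = A *v (P *v (transpose A *v w)) + Q *v w"
proof -
  have "e = (A ** P ** transpose A + Q) *v w"
    by (simp add: w_def sym_pos_def_mat_inv_cancel[OF sym_pos_def_mat_prediction])
  then show ?thesis
    by (simp add: matrix_vector_mult_add_rdistrib flip: matrix_vector_mul_assoc)
qed

text \<open>The value \<open>e \<bullet> S\<^sup>-\<^sup>1 e\<close> is the minimum over \<open>x\<close> of the right-hand side, attained at the
  smoothed state.\<close>

lemma smoothing_identity:
  fixes e :: "real^'m"
  defines "x \<equiv> matrix_inv (matrix_inv P + transpose A ** matrix_inv Q ** A) *v
      (transpose A *v (matrix_inv Q *v e))"
  shows "e \<bullet> (matrix_inv (A ** P ** transpose A + Q) *v e) =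
    x \<bullet> (matrix_inv P *v x) + (e - A *v x) \<bullet> (matrix_inv Q *v (e - A *v x))"
proof -
  define w where "w = matrix_inv (A ** P ** transpose A + Q) *v e"
  define p where "p = P *v (transpose A *v w)"
  note cancel = sym_pos_def_mat_inv_cancel[OF P] sym_pos_def_mat_inv_cancel[OF Q]
  have e: "e = A *v p + Q *v w"
    using prediction_split[of e] by (simp add: w_def p_def)
  have spd: "sym_pos_def_mat (matrix_inv P + transpose A ** matrix_inv Q ** A)"
    by (intro sym_pos_def_mat_add_congruence sym_pos_def_mat_matrix_inv P Q)
  \<comment> \<open>\<open>p\<close> solves the normal equations of the smoothing problem, so it is
    the smoothed state; no matrix inversion lemma is involved.\<close>
  have "transpose A *v (matrix_inv Q *v e)
      = (matrix_inv P + transpose A ** matrix_inv Q ** A) *v p"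
    unfolding e
    by (simp add: matrix_vector_right_distrib matrix_vector_mult_add_rdistrib cancel p_def
        flip: matrix_vector_mul_assoc)
  then have "x = p"
    unfolding x_def by (simp add: sym_pos_def_mat_inv_cancel[OF spd])
  have "x \<bullet> (matrix_inv P *v x) + (e - A *v x) \<bullet> (matrix_inv Q *v (e - A *v x))
      = p \<bullet> (transpose A *v w) + (Q *v w) \<bullet> w"
    unfolding \<open>x = p\<close> e by (simp add: cancel) (simp add: p_def cancel)
  also have "\<dots> = e \<bullet> w"
    unfolding e by (simp add: inner_matrix_transpose transpose_transpose inner_add_left)
  finally show ?thesis
    by (simp add: w_def)
qed

text \<open>Inversion reverses the order, and the prediction covariance dominates \<open>Q\<close>.
  The bound does not depend on \<open>P\<close>, hence will be uniform in time.\<close>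

lemma inverse_prediction_le:
  fixes e :: "real^'m"
  shows "e \<bullet> (matrix_inv (A ** P ** transpose A + Q) *v e) \<le> e \<bullet> (matrix_inv Q *v e)"
proof -
  define w where "w = matrix_inv (A ** P ** transpose A + Q) *v e"
  define a where "a = A *v (P *v (transpose A *v w))"
  have e: "e = a + Q *v w"
    using prediction_split[of e] by (simp add: w_def a_def)
  have "e \<bullet> (matrix_inv Q *v e) = a \<bullet> (matrix_inv Q *v a) + a \<bullet> w
      + (Q *v w) \<bullet> (matrix_inv Q *v a) + (Q *v w) \<bullet> w"
    unfolding e by (simp add: matrix_vector_right_distrib inner_add_left inner_add_right
        sym_pos_def_mat_inv_cancel[OF Q])
  also have "(Q *v w) \<bullet> (matrix_inv Q *v a) = w \<bullet> a"
    by (simp add: sym_pos_def_mat_inv_cancel[OF Q] flip: sym_pos_def_mat_commute[OF Q])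
  also have "a \<bullet> (matrix_inv Q *v a) + a \<bullet> w + w \<bullet> a + (Q *v w) \<bullet> w
      = a \<bullet> (matrix_inv Q *v a) + w \<bullet> a + e \<bullet> w"
    by (simp add: e inner_add_left)
  finally have "e \<bullet> (matrix_inv Q *v e) = a \<bullet> (matrix_inv Q *v a) + w \<bullet> a + e \<bullet> w" .
  moreover have "0 \<le> a \<bullet> (matrix_inv Q *v a)"
    by (rule sym_pos_def_mat_nonneg[OF sym_pos_def_mat_matrix_inv[OF Q]])
  moreover have "w \<bullet> a = (transpose A *v w) \<bullet> (P *v (transpose A *v w))"
    by (simp add: a_def inner_matrix_transpose)
  then have "0 \<le> w \<bullet> a"
    using sym_pos_def_mat_nonneg[OF P] by simp
  ultimately show ?thesis
    by (simp add: w_def)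
qed

end

section \<open>Decay of dissipative backward trajectories\<close>

text \<open>The lower bound on \<open>V\<close> may depend on \<open>k\<close> here; uniformity is
  derived below. The upper bound starts at index 1, since \<open>V 0\<close> will come from the
  arbitrary initial covariance.\<close>

locale backward_dissipation =
  fixes E A :: "real^'n^'n1" and H :: "real^'n^'m"
    and V :: "nat \<Rightarrow> real^'n \<Rightarrow> real" and F :: "nat \<Rightarrow> real^'n \<Rightarrow> real^'n" and \<gamma> C :: real
  assumes det: "detectable E A H"
    and gamma_pos: "\<gamma> > 0" and C_pos: "C > 0"
    and V_pos_def: "\<And>k. \<exists>\<epsilon>>0. \<forall>x. \<epsilon> * (norm x)\<^sup>2 \<le> V k x"
    and V_upper: "\<And>k x. V (Suc k) x \<le> C * (norm x)\<^sup>2"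
    and V_step: "\<And>k y. V k (F k y) +
      \<gamma> * ((norm (E *v y - A *v F k y))\<^sup>2 + (norm (H *v y))\<^sup>2) \<le> V (Suc k) y"
begin

text \<open>\<open>traj k x i\<close> is the state at time \<open>k - i\<close> after rewinding from
  \<open>x\<close> at time \<open>k\<close>; it is meaningful for \<open>i \<le> k\<close>, before
  the subtraction truncates.\<close>

primrec traj :: "nat \<Rightarrow> real^'n \<Rightarrow> nat \<Rightarrow> real^'n" where
  "traj k x 0 = x"
| "traj k x (Suc i) = F (k - Suc i) (traj k x i)"

abbreviation cost :: "(nat \<Rightarrow> real^'n) \<Rightarrow> nat \<Rightarrow> real" where
  "cost z j \<equiv> (norm (E *v z j - A *v z (Suc j)))\<^sup>2 + (norm (H *v z j))\<^sup>2"

lemma V_nonneg: "0 \<le> V k x"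
  using V_pos_def[of k] by (smt (verit) mult_nonneg_nonneg zero_le_power2)

text \<open>The dissipation inequality telescopes over a window of length \<open>j\<close> starting
  after \<open>i\<close> steps.\<close>

lemma energy:
  "i + j \<le> k \<Longrightarrow> V (k - (i + j)) (traj k x (i + j)) + \<gamma> * (\<Sum>l<j. cost (\<lambda>l. traj k x (i + l)) l)
    \<le> V (k - i) (traj k x i)"
proof (induction j)
  case (Suc j)
  then have "k - (i + j) = Suc (k - (i + Suc j))"
    by simp
  then have "V (k - (i + Suc j)) (traj k x (i + Suc j)) + \<gamma> * cost (\<lambda>l. traj k x (i + l)) j
      \<le> V (k - (i + j)) (traj k x (i + j))"
    using V_step[of "k - (i + Suc j)" "traj k x (i + j)"] by simp
  then show ?case
    using Suc by (simp add: algebra_simps)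
qed simp

lemma V_antimono_traj:
  assumes "i \<le> j" "j \<le> k"
  shows "V (k - j) (traj k x j) \<le> V (k - i) (traj k x i)"
proof -
  have "0 \<le> \<gamma> * (\<Sum>l<j - i. cost (\<lambda>l. traj k x (i + l)) l)"
    using gamma_pos by (intro mult_nonneg_nonneg sum_nonneg) auto
  then show ?thesis
    using energy[of i "j - i" k x] assms by simp
qed

text \<open>Rewinding to the time at which the trajectory is largest makes it bounded backwards, so
  that uniform observability applies with constant 1.\<close>

lemma V_lower_bound: "\<exists>\<epsilon>>0. \<forall>k x. \<epsilon> * (norm x)\<^sup>2 \<le> V k x"
proof -
  obtain N \<delta> where "\<delta> > 0" and obs: "\<And>z. (\<forall>j\<le>N. norm (z j) \<le> 1 * norm (z 0)) \<Longrightarrow>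
      \<delta> * (norm (z 0))\<^sup>2 \<le> (\<Sum>j<N. cost z j)"
    using uniform_observability[OF det, of 1] by blast
  obtain e where e: "\<And>k. e k > 0" "\<And>k x. e k * (norm x)\<^sup>2 \<le> V k x"
    using V_pos_def by metis
  \<comment> \<open>The first term serves windows that fit before time 0; the second covers the
    finitely many remaining times, where the individual bounds suffice.\<close>
  define \<epsilon> where "\<epsilon> = min (\<gamma> * \<delta>) (Min (e ` {..N}))"
  have "\<epsilon> > 0"
    using \<open>\<delta> > 0\<close> gamma_pos e(1) by (simp add: \<epsilon>_def)
  moreover have "\<epsilon> * (norm x)\<^sup>2 \<le> V k x" for k x
  proof -
    obtain i where i: "i \<le> k" "\<And>j. j \<le> k \<Longrightarrow> norm (traj k x j) \<le> norm (traj k x i)"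
      using exists_argmax_atMost[of k "\<lambda>i. norm (traj k x i)"] by blast
    have "\<epsilon> * (norm (traj k x i))\<^sup>2 \<le> V (k - i) (traj k x i)"
    proof (cases "i + N \<le> k")
      case True
      have "\<delta> * (norm (traj k x (i + 0)))\<^sup>2 \<le> (\<Sum>l<N. cost (\<lambda>l. traj k x (i + l)) l)"
        by (rule obs) (use i True in auto)
      then have "\<gamma> * \<delta> * (norm (traj k x i))\<^sup>2 \<le> \<gamma> * (\<Sum>l<N. cost (\<lambda>l. traj k x (i + l)) l)"
        using gamma_pos by (simp add: mult.assoc)
      also have "\<dots> \<le> V (k - i) (traj k x i)"
        using energy[OF True, of x] V_nonneg[of "k - (i + N)" "traj k x (i + N)"] by linarith
      finally show ?thesis
        using mult_right_mono[of \<epsilon> "\<gamma> * \<delta>" "(norm (traj k x i))\<^sup>2"] by (simp add: \<epsilon>_def)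
    next
      case False
      then have "Min (e ` {..N}) \<le> e (k - i)"
        by (intro Min_le) auto
      then have "\<epsilon> * (norm (traj k x i))\<^sup>2 \<le> e (k - i) * (norm (traj k x i))\<^sup>2"
        by (intro mult_right_mono) (auto simp: \<epsilon>_def)
      then show ?thesis
        using e(2) order_trans by blast
    qed
    moreover have "\<epsilon> * (norm x)\<^sup>2 \<le> \<epsilon> * (norm (traj k x i))\<^sup>2"
      using i(2)[of 0] \<open>\<epsilon> > 0\<close> by (intro mult_left_mono power_mono) auto
    moreover have "V (k - i) (traj k x i) \<le> V k x"
      using V_antimono_traj[of 0 i k x] i(1) by simp
    ultimately show ?thesis by linarith
  qed
  ultimately show ?thesis by blast
qed

text \<open>The two-sided bound on \<open>V\<close> keeps a trajectory within \<open>K\<close> times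
  its start, so observability applies. The cost paid over a window is then at least the fraction
  \<open>\<gamma> * \<delta> / C\<close> of the initial value of \<open>V\<close>.\<close>

lemma V_contraction:
  "\<exists>N \<rho>. 0 < N \<and> 0 \<le> \<rho> \<and> \<rho> < 1 \<and> (\<forall>k x i. i + N \<le> k \<longrightarrow>
      V (k - (i + N)) (traj k x (i + N)) \<le> \<rho> * V (k - i) (traj k x i))"
proof -
  obtain \<epsilon> where \<epsilon>: "\<epsilon> > 0" "\<And>k x. \<epsilon> * (norm x)\<^sup>2 \<le> V k x"
    using V_lower_bound by blast
  define K where "K = sqrt (C / \<epsilon>)"
  obtain N \<delta> where "\<delta> > 0" and obs: "\<And>z. (\<forall>j\<le>N. norm (z j) \<le> K * norm (z 0)) \<Longrightarrow>
      \<delta> * (norm (z 0))\<^sup>2 \<le> (\<Sum>j<N. cost z j)"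
    using uniform_observability[OF det, of K] by blast
  define \<rho> where "\<rho> = max 0 (1 - \<gamma> * \<delta> / C)"
  \<comment> \<open>One extra step makes the window nonempty and \<open>k - i\<close> positive, as
    the upper bound on \<open>V\<close> requires. \<open>V\<close> does not increase over that
    step.\<close>
  have "V (k - (i + Suc N)) (traj k x (i + Suc N)) \<le> \<rho> * V (k - i) (traj k x i)"
    if k: "i + Suc N \<le> k" for k x i
  proof -
    obtain k' where k': "k - i = Suc k'"
      using k by (cases "k - i") auto
    have up: "V (k - i) (traj k x i) \<le> C * (norm (traj k x i))\<^sup>2"
      unfolding k' by (rule V_upper)
    have "norm (traj k x (i + j)) \<le> K * norm (traj k x i)" if "j \<le> N" for j
    proof -
      have "\<epsilon> * (norm (traj k x (i + j)))\<^sup>2 \<le> V (k - (i + j)) (traj k x (i + j))"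
        by (rule \<epsilon>)
      also have "\<dots> \<le> V (k - i) (traj k x i)"
        using that k by (intro V_antimono_traj) auto
      finally have "(norm (traj k x (i + j)))\<^sup>2 \<le> C / \<epsilon> * (norm (traj k x i))\<^sup>2"
        using up \<epsilon>(1) by (simp add: field_simps)
      also have "\<dots> = (K * norm (traj k x i))\<^sup>2"
        using C_pos \<epsilon>(1) by (simp add: K_def power_mult_distrib)
      finally show ?thesis
        by (rule power2_le_imp_le) (use C_pos \<epsilon>(1) in \<open>simp add: K_def\<close>)
    qed
    then have "\<delta> * (norm (traj k x (i + 0)))\<^sup>2 \<le> (\<Sum>l<N. cost (\<lambda>l. traj k x (i + l)) l)"
      by (intro obs) simp
    then have "\<gamma> * (\<delta> * (norm (traj k x i))\<^sup>2) \<le> \<gamma> * (\<Sum>l<N. cost (\<lambda>l. traj k x (i + l)) l)"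
      using gamma_pos by (intro mult_left_mono) auto
    then have "V (k - (i + N)) (traj k x (i + N)) \<le>
        V (k - i) (traj k x i) - \<gamma> * (\<delta> * (norm (traj k x i))\<^sup>2)"
      using energy[of i N k x] k by simp
    also have "\<gamma> * \<delta> / C * V (k - i) (traj k x i) \<le> \<gamma> * \<delta> / C * (C * (norm (traj k x i))\<^sup>2)"
      using up gamma_pos \<open>\<delta> > 0\<close> C_pos by (intro mult_left_mono) auto
    then have "V (k - i) (traj k x i) - \<gamma> * (\<delta> * (norm (traj k x i))\<^sup>2)
        \<le> (1 - \<gamma> * \<delta> / C) * V (k - i) (traj k x i)"
      using C_pos by (simp add: algebra_simps)
    also have "\<dots> \<le> \<rho> * V (k - i) (traj k x i)"
      by (intro mult_right_mono V_nonneg) (simp add: \<rho>_def)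
    finally show ?thesis
      using V_antimono_traj[of "i + N" "i + Suc N" k x] k by simp
  qed
  moreover have "0 \<le> \<rho>" "\<rho> < 1"
    using gamma_pos \<open>\<delta> > 0\<close> C_pos by (auto simp: \<rho>_def)
  ultimately show ?thesis
    by (intro exI[of _ "Suc N"] exI[of _ \<rho>]) auto
qed

lemma traj_uniformly_small:
  assumes "\<eta> > 0"
  shows "\<exists>J. \<forall>j\<ge>J. \<forall>k\<ge>j. \<forall>x. norm (traj (Suc k) x j) \<le> \<eta> * norm x"
proof -
  obtain \<epsilon> where \<epsilon>: "\<epsilon> > 0" "\<And>k x. \<epsilon> * (norm x)\<^sup>2 \<le> V k x"
    using V_lower_bound by blast
  obtain N \<rho> where \<rho>: "0 \<le> \<rho>" "\<rho> < 1" and contr: "\<And>k x i. i + N \<le> k \<Longrightarrow>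
      V (k - (i + N)) (traj k x (i + N)) \<le> \<rho> * V (k - i) (traj k x i)"
    using V_contraction by blast
  have geo: "q * N \<le> k \<Longrightarrow> V (k - q * N) (traj k x (q * N)) \<le> \<rho> ^ q * V k x" for q k x
  proof (induction q)
    case (Suc q)
    then have "V (k - Suc q * N) (traj k x (Suc q * N)) \<le> \<rho> * V (k - q * N) (traj k x (q * N))"
      using contr[of "q * N" k x] by (simp add: add.commute)
    also have "\<dots> \<le> \<rho> * (\<rho> ^ q * V k x)"
      using Suc \<rho> by (intro mult_left_mono) auto
    finally show ?case by (simp add: mult.assoc)
  qed simp
  \<comment> \<open>After \<open>q\<close> windows the decay factor absorbs the ratio
    \<open>C / \<epsilon>\<close> between the bounds on \<open>V\<close>.\<close>
  obtain q where q: "\<rho> ^ q < \<eta>\<^sup>2 * \<epsilon> / C"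
    using real_arch_pow_inv[of "\<eta>\<^sup>2 * \<epsilon> / C" \<rho>] assms \<epsilon> C_pos \<rho> by auto
  have "norm (traj (Suc k) x j) \<le> \<eta> * norm x" if "q * N \<le> j" "j \<le> k" for j k x
  proof -
    have "\<epsilon> * (norm (traj (Suc k) x j))\<^sup>2 \<le> V (Suc k - j) (traj (Suc k) x j)"
      by (rule \<epsilon>)
    also have "\<dots> \<le> V (Suc k - q * N) (traj (Suc k) x (q * N))"
      using that by (intro V_antimono_traj) auto
    also have "\<dots> \<le> \<rho> ^ q * V (Suc k) x"
      using that by (intro geo) auto
    also have "\<dots> \<le> \<rho> ^ q * (C * (norm x)\<^sup>2)"
      using \<rho> by (intro mult_left_mono V_upper) auto
    also have "\<dots> \<le> \<eta>\<^sup>2 * \<epsilon> / C * (C * (norm x)\<^sup>2)"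
      using q C_pos by (intro mult_right_mono) auto
    also have "\<dots> = \<epsilon> * (\<eta> * norm x)\<^sup>2"
      using C_pos by (simp add: power_mult_distrib)
    finally have "(norm (traj (Suc k) x j))\<^sup>2 \<le> (\<eta> * norm x)\<^sup>2"
      using \<epsilon>(1) by simp
    then show ?thesis
      by (rule power2_le_imp_le) (use assms in simp)
  qed
  then show ?thesis by blast
qed

end

section \<open>Application to the Riccati recursion\<close>

theorem theorem4:
  fixes E A :: "real^'n^'n1" and H :: "real^'n^'m"
    and P0 :: "real^'n^'n" and Q :: "real^'n1^'n1" and R :: "real^'m^'m"
  assumes "rank (hcat E A) = CARD('n1)"
    and "rank (vcat E H) = CARD('n)"
    and "sym_pos_def_mat P0" and "sym_pos_def_mat Q" and "sym_pos_def_mat R"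
    and "detectable E A H"
    and "stabilizable E A H Q R"
  shows "((\<lambda>(b, c). induced_norm2
            (matrix_inv (Gamma_sm E A H P0 Q R (b + 1)) ** Mmat E A H P0 Q R b c))
          \<longlongrightarrow> 0) (sequentially \<times>\<^sub>F sequentially)"
proof -
  define P where "P = Pplus E A H P0 Q R"
  define G where "G = Gamma_sm E A H P0 Q R"
  define F where "F k = (\<lambda>x. G k *v (transpose A *v (matrix_inv Q *v (E *v x))))" for k
  define V where "V k x = x \<bullet> (matrix_inv (P k) *v x)" for k x
  have G_eq: "G k = matrix_inv (matrix_inv (P k) + transpose A ** matrix_inv Q ** A)" for k
    by (simp add: G_def Gamma_sm_def P_def)
  note Q = assms(4) and R = assms(5)
  have Qi: "sym_pos_def_mat (matrix_inv Q)" and Ri: "sym_pos_def_mat (matrix_inv R)"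
    using Q R by (auto intro: sym_pos_def_mat_matrix_inv)
  have info: "sym_pos_def_mat (transpose E ** matrix_inv (A ** P' ** transpose A + Q) ** E
      + transpose H ** matrix_inv R ** H)" if "sym_pos_def_mat P'" for P'
    by (intro sym_pos_def_mat_congruence_add_congruence sym_pos_def_mat_matrix_inv
        sym_pos_def_mat_prediction assms that)
  have P: "sym_pos_def_mat (P k)" for k
  proof (induction k)
    case 0
    show ?case using assms(3) by (simp add: P_def)
  next
    case (Suc k)
    then show ?case
      using sym_pos_def_mat_matrix_inv[OF info] by (simp add: P_def)
  qed
  have "matrix_inv (P (Suc k)) = transpose E ** matrix_inv (A ** P k ** transpose A + Q) ** E
      + transpose H ** matrix_inv R ** H" for k
  proof -
    have "matrix_inv (matrix_inv M) = M" if "sym_pos_def_mat M" for M :: "real^'n^'n"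
      using sym_pos_def_mat_inv_cancel[OF that]
        sym_pos_def_mat_inv_cancel[OF sym_pos_def_mat_matrix_inv[OF that]]
      by (metis matrix_eq)
    from this[OF info[OF P[of k]]] show ?thesis
      by (simp add: P_def)
  qed
  then have V_Suc: "V (Suc k) y =
      (E *v y) \<bullet> (matrix_inv (A ** P k ** transpose A + Q) *v (E *v y))
      + (H *v y) \<bullet> (matrix_inv R *v (H *v y))" for k y
    by (simp add: V_def matrix_vector_mult_add_rdistrib inner_add_right inner_congruence)
  \<comment> \<open>This is the smoothing identity with \<open>e = E *v y\<close>, whose smoothed
    state is \<open>F k y\<close>.\<close>
  have V_Suc_step: "V (Suc k) y = V k (F k y)
      + (E *v y - A *v F k y) \<bullet> (matrix_inv Q *v (E *v y - A *v F k y))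
      + (H *v y) \<bullet> (matrix_inv R *v (H *v y))" for k y
    unfolding V_Suc smoothing_identity[OF P Q] by (simp add: V_def F_def G_eq)
  obtain \<alpha> where \<alpha>: "\<alpha> > 0" "\<And>x. \<alpha> * (norm x)\<^sup>2 \<le> x \<bullet> (matrix_inv Q *v x)"
    using sym_pos_def_mat_lower_bound[OF Qi] by blast
  obtain \<beta> where \<beta>: "\<beta> > 0" "\<And>x. \<beta> * (norm x)\<^sup>2 \<le> x \<bullet> (matrix_inv R *v x)"
    using sym_pos_def_mat_lower_bound[OF Ri] by blast
  \<comment> \<open>Replacing the prediction covariance by \<open>Q\<close> gives one form that
    dominates \<open>V\<close> at all positive times.\<close>
  obtain C where C: "C > 0" "\<And>x. x \<bullet> ((transpose E ** matrix_inv Q ** E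
      + transpose H ** matrix_inv R ** H) *v x) \<le> C * (norm x)\<^sup>2"
    using quadratic_form_upper_bound by blast
  interpret backward_dissipation E A H V F "min \<alpha> \<beta>" C
  proof
    fix k x
    show "\<exists>\<epsilon>>0. \<forall>x. \<epsilon> * (norm x)\<^sup>2 \<le> V k x"
      unfolding V_def by (rule sym_pos_def_mat_lower_bound[OF sym_pos_def_mat_matrix_inv[OF P]])
    have "V (Suc k) x \<le> (E *v x) \<bullet> (matrix_inv Q *v (E *v x))
      + (H *v x) \<bullet> (matrix_inv R *v (H *v x))"
      unfolding V_Suc using inverse_prediction_le[OF P Q] by simp
    also have "\<dots> \<le> C * (norm x)\<^sup>2"
      using C(2)[of x] by (simp add: matrix_vector_mult_add_rdistrib inner_add_right inner_congruence)
    finally show "V (Suc k) x \<le> C * (norm x)\<^sup>2" .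
    have "min \<alpha> \<beta> * r \<le> \<alpha> * r" "min \<alpha> \<beta> * r \<le> \<beta> * r" if "0 \<le> r" for r
      using that by (auto intro: mult_right_mono)
    then have "min \<alpha> \<beta> * (norm (E *v x - A *v F k x))\<^sup>2
        \<le> (E *v x - A *v F k x) \<bullet> (matrix_inv Q *v (E *v x - A *v F k x))"
      "min \<alpha> \<beta> * (norm (H *v x))\<^sup>2 \<le> (H *v x) \<bullet> (matrix_inv R *v (H *v x))"
      using \<alpha>(2) \<beta>(2) by (meson order_trans zero_le_power2)+
    then show "V k (F k x) + min \<alpha> \<beta> *
        ((norm (E *v x - A *v F k x))\<^sup>2 + (norm (H *v x))\<^sup>2) \<le> V (Suc k) x"
      unfolding V_Suc_step distrib_left by linarith
  qed (use assms \<alpha> \<beta> C in auto)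

  \<comment> \<open>The recursion appends factors on the right; peeling off the leftmost one instead
    raises the base \<open>b\<close> by one.\<close>
  have M_Suc: "Mprod E A H P0 Q R b (Suc j) *v x = F (Suc b) (Mprod E A H P0 Q R (Suc b) j *v x)"
    for b j x
    by (induction j arbitrary: x) (simp_all add: F_def G_def flip: matrix_vector_mul_assoc)
  have M_traj: "Mprod E A H P0 Q R b j *v x = traj (Suc (b + j)) x j" for b j x
  proof (induction j arbitrary: b)
    case (Suc j)
    then show ?case
      unfolding M_Suc by simp
  qed simp
  define L where "L = transpose A ** matrix_inv Q ** E"
  have "matrix_inv (G k) *v (G k *v x) = x" for k x
    unfolding G_eq
    by (intro sym_pos_def_mat_inv_cancel sym_pos_def_mat_matrix_inv sym_pos_def_mat_add_congruence
        Q P)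
  \<comment> \<open>\<open>Mmat\<close> at \<open>c = j + 2\<close> has \<open>j + 1\<close>
    factors. The inverse cancels the leading \<open>G (b + 1)\<close>, which leaves the fixed matrix
    \<open>L\<close> and a trajectory of \<open>j\<close> steps.\<close>
  then have key: "(matrix_inv (G (b + 1)) ** Mmat E A H P0 Q R b (Suc (Suc j))) *v x
      = L *v traj (Suc (Suc b + j)) x j" for b j x
    unfolding Mmat_def matrix_vector_mul_assoc[symmetric] diff_Suc_1 M_Suc M_traj
    by (simp add: F_def L_def flip: matrix_vector_mul_assoc)
  have bl: "bounded_linear ((*v) L)"
    by (rule matrix_vector_mul_bounded_linear)
  have L_nonneg: "0 \<le> onorm ((*v) L)"
    by (rule onorm_pos_le[OF bl])
  have norm_nonneg: "0 \<le> induced_norm2 M" for M :: "real^'n^'n"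
    unfolding induced_norm2_def by (rule onorm_pos_le[OF matrix_vector_mul_bounded_linear])
  show ?thesis
  proof (rule tendstoI)
    fix \<eta> :: real assume "\<eta> > 0"
    \<comment> \<open>Adding 1 keeps the denominator positive when \<open>L\<close> is zero.\<close>
    define \<theta> where "\<theta> = \<eta> / 2 / (onorm ((*v) L) + 1)"
    have "\<theta> > 0"
      using \<open>\<eta> > 0\<close> L_nonneg by (simp add: \<theta>_def)
    then obtain J where J: "\<And>j k x. J \<le> j \<Longrightarrow> j \<le> k \<Longrightarrow> norm (traj (Suc k) x j) \<le> \<theta> * norm x"
      using traj_uniformly_small by blast
    have bound: "onorm ((*v) L) * \<theta> < \<eta>"
    proof -
      have "onorm ((*v) L) * \<theta> \<le> (onorm ((*v) L) + 1) * \<theta>"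
        using \<open>\<theta> > 0\<close> by simp
      also have "\<dots> = \<eta> / 2"
        using L_nonneg nonzero_mult_div_cancel_left[of "onorm ((*v) L) + 1" "\<eta> / 2"]
        unfolding \<theta>_def times_divide_eq_right by linarith
      finally show ?thesis
        using \<open>\<eta> > 0\<close> by simp
    qed
    \<comment> \<open>The threshold on \<open>c\<close> is uniform in \<open>b\<close>, which gives
      the joint limit.\<close>
    have "induced_norm2 (matrix_inv (G (b + 1)) ** Mmat E A H P0 Q R b c) < \<eta>"
      if "c \<ge> J + 2" for b c
    proof -
      define j where "j = c - 2"
      have j: "c = Suc (Suc j)" "J \<le> j"
        using that by (auto simp: j_def)
      have "norm ((matrix_inv (G (b + 1)) ** Mmat E A H P0 Q R b c) *v x)
          \<le> onorm ((*v) L) * \<theta> * norm x" for x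
      proof -
        have "norm (L *v traj (Suc (Suc b + j)) x j)
            \<le> onorm ((*v) L) * norm (traj (Suc (Suc b + j)) x j)"
          by (rule onorm[OF bl])
        also have "\<dots> \<le> onorm ((*v) L) * (\<theta> * norm x)"
          using j L_nonneg by (intro mult_left_mono J) auto
        finally show ?thesis
          unfolding j key by (simp add: mult.assoc)
      qed
      then have "induced_norm2 (matrix_inv (G (b + 1)) ** Mmat E A H P0 Q R b c)
          \<le> onorm ((*v) L) * \<theta>"
        unfolding induced_norm2_def using L_nonneg \<open>\<theta> > 0\<close> by (intro onorm_bound) auto
      then show ?thesis
        using bound by linarith
    qed
    then show "\<forall>\<^sub>F p in sequentially \<times>\<^sub>F sequentially.
        dist (case p of (b, c) \<Rightarrow> induced_norm2
          (matrix_inv (Gamma_sm E A H P0 Q R (b + 1)) ** Mmat E A H P0 Q R b c)) 0 < \<eta>"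
      unfolding eventually_prod_sequentially G_def
      by (intro exI[of _ "J + 2"]) (simp add: norm_nonneg)
  qed
qed

end
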